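(* There is an algorithm that, given an arbitrary finite set $\mathcal{S}$ of Pauli operators on a common system of qubits, correctly decides whether or not $\mathcal{S}$ is contextual in $O(|\mathcal{S}|^3)$ steps, where one step is a test of whether two given operators in $\mathcal{S}$ commute. Specifically: let $\mathcal{T}\subseteq\mathcal{S}$ be obtained by removing every operator that commutes with all others in $\mathcal{S}$, and search among the triples of operators in $\mathcal{T}$ for $A,B,C\in\mathcal{T}$ such that $A$ commutes with $B$ and with $C$, but $B$ and $C$ anticommute; then $\mathcal{S}$ is contextual if such a triple exists, and $\mathcal{S}$ is noncontextual if no such triple exists.
   Context: Pauli operators: fix a number of qubits $N\ge 1$. A Pauli operator is an operator $\pm\, P_1\otimes\cdots\otimes P_N$ with each $P_i\in\{I,X,Y,Z\}$ (the $2\times 2$ identity and the Pauli matrices). Any two Pauli operators either commute or anticommute, and each squares to the identity. Operators are compared including their sign, so $A$ and $-A$ are different operators. Determining tree: a determining tree for a Pauli operator $A$ over a set $\mathcal{S}$ of Pauli operators is a finite rooted tree whose nodes are (labelled by) Pauli operators, with repetitions allowed, and whose leaves are operators in $\mathcal{S}$, such that (1) the root is $A$; (2) all children of any particular parent pairwise commute as operators; (3) every parent node is the operator product of its children. (A single node $B\in\mathcal{S}$ is a determining tree for $B$.) Determining set: the determining set of a determining tree is the set containing one copy of each operator that occurs with odd multiplicity as a leaf of the tree. Contextual: a set $\mathcal{S}$ of Pauli operators is contextual if for some Pauli operator $A$ there exist a determining tree $\tau$ for $A$ over $\mathcal{S}$ and a determining tree $\tau'$ for $-A$ over $\mathcal{S}$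 such that the determining sets of $\tau$ and $\tau'$ are identical. Otherwise it is noncontextual. *)

theory Defs
  imports "Jordan_Normal_Form.Matrix"
begin

section \<open>Pauli operators\<close>

definition pauli_I :: "complex mat" where
  "pauli_I = mat_of_rows_list 2 [[1, 0], [0, 1]]"

definition pauli_X :: "complex mat" where
  "pauli_X = mat_of_rows_list 2 [[0, 1], [1, 0]]"

definition pauli_Y :: "complex mat" where
  "pauli_Y = mat_of_rows_list 2 [[0, - \<i>], [\<i>, 0]]"

definition pauli_Z :: "complex mat" where
  "pauli_Z = mat_of_rows_list 2 [[1, 0], [0, - 1]]"

text \<open>The Kronecker product, i.e. the matrix of the tensor product of two operators.\<close>

definition kron :: "complex mat \<Rightarrow> complex mat \<Rightarrow> complex mat" where
  "kron A B = mat (dim_row A * dim_row B) (dim_col A * dim_col B)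
     (\<lambda>(i, j). A $$ (i div dim_row B, j div dim_col B) * B $$ (i mod dim_row B, j mod dim_col B))"

definition kron_list :: "complex mat list \<Rightarrow> complex mat" where
  "kron_list Ps = foldr kron Ps (1\<^sub>m 1)"

definition pauli_ops :: "nat \<Rightarrow> complex mat set" where
  "pauli_ops N = {s \<cdot>\<^sub>m kron_list Ps | s Ps.
     s \<in> {1, - 1} \<and> length Ps = N \<and> set Ps \<subseteq> {pauli_I, pauli_X, pauli_Y, pauli_Z}}"

definition commute :: "complex mat \<Rightarrow> complex mat \<Rightarrow> bool" where
  "commute A B \<longleftrightarrow> A * B = B * A"

definition anticommute :: "complex mat \<Rightarrow> complex mat \<Rightarrow> bool" where
  "anticommute A B \<longleftrightarrow> A * B = - (B * A)"


section \<open>Determining trees and contextuality\<close>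

text \<open>Finite rooted trees; a node without children is a leaf. The children are listed in some
  order, which is immaterial for determining trees because there siblings commute.\<close>

datatype 'a rtree = Node (root: 'a) (children: "'a rtree list")

fun leaves :: "'a rtree \<Rightarrow> 'a list" where
  "leaves (Node A ts) = (if ts = [] then [A] else concat (map leaves ts))"

definition op_prod :: "nat \<Rightarrow> complex mat list \<Rightarrow> complex mat" where
  "op_prod N As = foldr (*) As (1\<^sub>m (2 ^ N))"

inductive determining_tree :: "nat \<Rightarrow> complex mat set \<Rightarrow> complex mat rtree \<Rightarrow> bool"
  for N :: nat and S :: "complex mat set" where
  leaf: "B \<in> pauli_ops N \<Longrightarrow> B \<in> S \<Longrightarrow> determining_tree N S (Node B [])"
| parent: "A \<in> pauli_ops N \<Longrightarrow> ts \<noteq> [] \<Longrightarrow>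
    (\<forall>t \<in> set ts. determining_tree N S t) \<Longrightarrow>
    (\<forall>t \<in> set ts. \<forall>u \<in> set ts. commute (root t) (root u)) \<Longrightarrow>
    A = op_prod N (map root ts) \<Longrightarrow>
    determining_tree N S (Node A ts)"

definition determining_tree_for ::
    "nat \<Rightarrow> complex mat set \<Rightarrow> complex mat \<Rightarrow> complex mat rtree \<Rightarrow> bool" where
  "determining_tree_for N S A t \<longleftrightarrow> determining_tree N S t \<and> root t = A"

definition determining_set :: "'a rtree \<Rightarrow> 'a set" where
  "determining_set t = {B. odd (count_list (leaves t) B)}"

definition contextual :: "nat \<Rightarrow> complex mat set \<Rightarrow> bool" where
  "contextual N S \<longleftrightarrow> (\<exists>A \<in> pauli_ops N. \<exists>t t'.
     determining_tree_for N S A t \<and> determining_tree_for N S (- A) t' \<and>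
     determining_set t = determining_set t')"

definition remove_central :: "complex mat set \<Rightarrow> complex mat set" where
  "remove_central S = S - {A \<in> S. \<forall>B \<in> S - {A}. commute A B}"


section \<open>Algorithms based on commutation tests\<close>

text \<open>An algorithm over an abstract type of operators either returns a result or tests
  whether two operators commute and continues depending on the answer. The set function
  \<open>tested\<close> collects the operators tested on any branch.\<close>

datatype (tested: 'a, 'r) algorithm =
    Return 'r
  | Test 'a 'a "bool \<Rightarrow> ('a, 'r) algorithm"

text \<open>Running an algorithm, given the true answers \<open>c\<close> to the tests: its result and
  the number of tests performed.\<close>

primrec result :: "('a \<Rightarrow> 'a \<Rightarrow> bool) \<Rightarrow> ('a, 'r) algorithm \<Rightarrow> 'r" where
  "result c (Return r) = r"
| "result c (Test A B k) = result c (k (c A B))"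

primrec steps :: "('a \<Rightarrow> 'a \<Rightarrow> bool) \<Rightarrow> ('a, 'r) algorithm \<Rightarrow> nat" where
  "steps c (Return r) = 0"
| "steps c (Test A B k) = Suc (steps c (k (c A B)))"

primrec andthen ::
    "('a, 'r) algorithm \<Rightarrow> ('r \<Rightarrow> ('a, 's) algorithm) \<Rightarrow> ('a, 's) algorithm" where
  "andthen (Return r) f = f r"
| "andthen (Test A B k) f = Test A B (\<lambda>b. andthen (k b) f)"

primrec search :: "('b \<Rightarrow> ('a, bool) algorithm) \<Rightarrow> 'b list \<Rightarrow> ('a, bool) algorithm" where
  "search p [] = Return False"
| "search p (x # xs) = andthen (p x) (\<lambda>b. if b then Return True else search p xs)"

primrec select :: "('b \<Rightarrow> ('a, bool) algorithm) \<Rightarrow> 'b list \<Rightarrow> ('a, 'b list) algorithm" where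
  "select p [] = Return []"
| "select p (x # xs) =
     andthen (p x) (\<lambda>b. andthen (select p xs) (\<lambda>ys. Return (if b then x # ys else ys)))"

text \<open>The decision algorithm is polymorphic in the type of operators: it has no access to
  them other than through the tests. As every operator commutes with itself, testing against
  the whole list amounts to testing against the others; Pauli operators that do not commute
  anticommute.\<close>

definition noncentral :: "'a list \<Rightarrow> ('a, 'a list) algorithm" where
  "noncentral S = select (\<lambda>A. search (\<lambda>B. Test A B (\<lambda>ab. Return (\<not> ab))) S) S"

definition triple_test :: "'a \<Rightarrow> 'a \<Rightarrow> 'a \<Rightarrow> ('a, bool) algorithm" where
  "triple_test A B C =
     Test A B (\<lambda>ab. Test A C (\<lambda>ac. Test B C (\<lambda>bc. Return (ab \<and> ac \<and> \<not> bc))))"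

definition decide_contextual :: "'a list \<Rightarrow> ('a, bool) algorithm" where
  "decide_contextual S = andthen (noncentral S)
     (\<lambda>T. search (\<lambda>A. search (\<lambda>B. search (\<lambda>C. triple_test A B C) T) T) T)"

end

theory Submission
  imports Defs
begin

text \<open>If \<open>A\<close> commutes with \<open>B\<close> and \<open>C\<close>, while \<open>B\<close> and \<open>C\<close> anticommute, choose a \<open>D\<close> in the set that
  anticommutes with \<open>A\<close>. If \<open>D\<close> commutes with \<open>B\<close> and \<open>C\<close>, then \<open>(AB)(CD) = -(AC)(BD)\<close> is a
  Peres-Mermin square, and its two sides are determining trees with the same leaves. The other cases
  reduce to this one by passing to the operators \<open>A, B, C, DB\<close> or \<open>A, C, B, DC\<close> or \<open>A, AB, AC, D\<close>.

  If there is no such triple, commutation is an equivalence relation on the noncentral operators.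
  Multiplying every noncentral operator by a representative of its class yields operators that
  commute with the whole set. Hence the root of a determining tree is a product of
  pairwise commuting involutions, one for each leaf, times at most one representative, which
  is detected by the parities of the numbers of leaves in the classes. So the root
  depends only on the determining set.\<close>

section \<open>Kronecker products\<close>

lemma kron_carrier [simp]:
  "A \<in> carrier_mat a b \<Longrightarrow> B \<in> carrier_mat c d \<Longrightarrow> kron A B \<in> carrier_mat (a * c) (b * d)"
  by (auto simp: kron_def)

lemma div_less_of_less_mult: "i < a * b \<Longrightarrow> i div b < a" for a b i :: nat
  by (simp add: less_mult_imp_div_less)

lemma mod_less_of_less_mult: "i < a * b \<Longrightarrow> i mod b < b" for a b i :: nat
  by (metis mod_less_divisor mult_0_right not_gr_zero not_less_zero)

text \<open>The pairs \<open>(i, j)\<close> correspond to the indices \<open>i * b + j\<close>. This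
  splits the inner index of a product of two Kronecker products into one index for each
  factor.\<close>

lemma sum_div_mod:
  fixes f :: "nat \<Rightarrow> nat \<Rightarrow> 'a :: comm_monoid_add"
  shows "(\<Sum>k = 0..<a * b. f (k div b) (k mod b)) = (\<Sum>i = 0..<a. \<Sum>j = 0..<b. f i j)"
proof -
  have bound: "i * b + j < a * b" if "i < a" "j < b" for i j
  proof -
    have "i * b + j < Suc i * b" using that by simp
    also have "\<dots> \<le> a * b" using that by (intro mult_le_mono1) simp
    finally show ?thesis .
  qed
  have "(\<Sum>k = 0..<a * b. f (k div b) (k mod b)) = (\<Sum>(i, j) \<in> {0..<a} \<times> {0..<b}. f i j)"
    by (rule sum.reindex_bij_witness[of _ "\<lambda>(i, j). i * b + j" "\<lambda>k. (k div b, k mod b)"])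
       (auto simp: div_less_of_less_mult mod_less_of_less_mult bound)
  then show ?thesis by (simp add: sum.cartesian_product)
qed

text \<open>Each entry is a double sum whose summand is a product of a term in \<open>k\<close> and
  a term in \<open>l\<close>, so it factors into an entry of \<open>A * C\<close> and an entry of
  \<open>B * D\<close>.\<close>

lemma kron_mult:
  assumes "A \<in> carrier_mat a b" "C \<in> carrier_mat b e" "B \<in> carrier_mat c d" "D \<in> carrier_mat d f"
  shows "kron A B * kron C D = kron (A * C) (B * D)"
proof (rule eq_matI)
  fix i j assume "i < dim_row (kron (A * C) (B * D))" "j < dim_col (kron (A * C) (B * D))"
  then have ij: "i < a * c" "j < e * f" using assms by (auto simp: kron_def)
  let ?i = "i div c" and ?i' = "i mod c" and ?j = "j div f" and ?j' = "j mod f"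
  have "(kron A B * kron C D) $$ (i, j) =
      (\<Sum>k = 0..<b * d. (A $$ (?i, k div d) * B $$ (?i', k mod d)) * (C $$ (k div d, ?j) * D $$ (k mod d, ?j')))"
    using assms ij by (auto simp: kron_def scalar_prod_def intro!: sum.cong)
  also have "\<dots> = (\<Sum>k = 0..<b. \<Sum>l = 0..<d. (A $$ (?i, k) * B $$ (?i', l)) * (C $$ (k, ?j) * D $$ (l, ?j')))"
    by (rule sum_div_mod)
  also have "\<dots> = (\<Sum>k = 0..<b. A $$ (?i, k) * C $$ (k, ?j)) * (\<Sum>l = 0..<d. B $$ (?i', l) * D $$ (l, ?j'))"
    by (simp add: sum_product mult_ac)
  also have "\<dots> = kron (A * C) (B * D) $$ (i, j)"
    using assms ij
    by (auto simp: kron_def scalar_prod_def div_less_of_less_mult mod_less_of_less_mult)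
  finally show "(kron A B * kron C D) $$ (i, j) = kron (A * C) (B * D) $$ (i, j)" .
qed (use assms in \<open>auto simp: kron_def\<close>)

lemma kron_smult: "kron (c \<cdot>\<^sub>m A) (d \<cdot>\<^sub>m B) = (c * d) \<cdot>\<^sub>m kron A B"
  by (rule eq_matI) (auto simp: kron_def div_less_of_less_mult mod_less_of_less_mult)

lemma kron_one: "kron (1\<^sub>m a) (1\<^sub>m b) = 1\<^sub>m (a * b)"
proof (rule eq_matI)
  fix i j assume "i < dim_row (1\<^sub>m (a * b) :: complex mat)" "j < dim_col (1\<^sub>m (a * b) :: complex mat)"
  moreover have "i = j" if "i div b = j div b" "i mod b = j mod b"
    using that by (metis div_mult_mod_eq)
  ultimately show "kron (1\<^sub>m a) (1\<^sub>m b) $$ (i, j) = 1\<^sub>m (a * b) $$ (i, j)"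
    by (auto simp: kron_def div_less_of_less_mult mod_less_of_less_mult)
qed (auto simp: kron_def)

section \<open>The algebra of Pauli operators\<close>

definition paulis :: "complex mat set" where
  "paulis = {pauli_I, pauli_X, pauli_Y, pauli_Z}"

text \<open>The fourth roots of unity: the scalars that occur in \<open>pauli_table\<close>.\<close>

definition phases :: "complex set" where
  "phases = {1, - 1, \<i>, - \<i>}"

lemma phases_mult: "c \<in> phases \<Longrightarrow> d \<in> phases \<Longrightarrow> c * d \<in> phases"
  by (auto simp: phases_def)

lemma pauli_carrier: "P \<in> paulis \<Longrightarrow> P \<in> carrier_mat 2 2"
  by (auto simp: paulis_def pauli_I_def pauli_X_def pauli_Y_def pauli_Z_def mat_of_rows_list_def)

lemmas pauli_defs = pauli_I_def pauli_X_def pauli_Y_def pauli_Z_def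

lemma pauli_table:
  "pauli_I * pauli_I = 1 \<cdot>\<^sub>m pauli_I" "pauli_I * pauli_X = 1 \<cdot>\<^sub>m pauli_X"
  "pauli_I * pauli_Y = 1 \<cdot>\<^sub>m pauli_Y" "pauli_I * pauli_Z = 1 \<cdot>\<^sub>m pauli_Z"
  "pauli_X * pauli_I = 1 \<cdot>\<^sub>m pauli_X" "pauli_X * pauli_X = 1 \<cdot>\<^sub>m pauli_I"
  "pauli_X * pauli_Y = \<i> \<cdot>\<^sub>m pauli_Z" "pauli_X * pauli_Z = (- \<i>) \<cdot>\<^sub>m pauli_Y"
  "pauli_Y * pauli_I = 1 \<cdot>\<^sub>m pauli_Y" "pauli_Y * pauli_X = (- \<i>) \<cdot>\<^sub>m pauli_Z"
  "pauli_Y * pauli_Y = 1 \<cdot>\<^sub>m pauli_I" "pauli_Y * pauli_Z = \<i> \<cdot>\<^sub>m pauli_X"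
  "pauli_Z * pauli_I = 1 \<cdot>\<^sub>m pauli_Z" "pauli_Z * pauli_X = \<i> \<cdot>\<^sub>m pauli_Y"
  "pauli_Z * pauli_Y = (- \<i>) \<cdot>\<^sub>m pauli_X" "pauli_Z * pauli_Z = 1 \<cdot>\<^sub>m pauli_I"
  by (rule eq_matI; auto simp: pauli_defs mat_of_rows_list_def scalar_prod_def less_Suc_eq
        numeral_2_eq_2)+

lemma pauli_I_eq_one: "pauli_I = 1\<^sub>m 2"
  by (rule eq_matI) (auto simp: pauli_defs mat_of_rows_list_def less_Suc_eq numeral_2_eq_2)

text \<open>Both orders are expressed by the same \<open>R\<close> and \<open>c\<close>, so that
  \<open>s\<close> alone records whether the factors commute or anticommute.\<close>

lemma pauli_mult:
  assumes "P \<in> paulis" "Q \<in> paulis"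
  shows "\<exists>c \<in> phases. \<exists>s \<in> {1, - 1}. \<exists>R \<in> paulis.
    P * Q = c \<cdot>\<^sub>m R \<and> Q * P = (s * c) \<cdot>\<^sub>m R"
  using assms unfolding paulis_def phases_def
  by (elim insertE emptyE; hypsubst) (simp_all add: pauli_table)

section \<open>Tensor products of Pauli matrices\<close>

lemma kron_list_carrier:
  "set Ps \<subseteq> paulis \<Longrightarrow> kron_list Ps \<in> carrier_mat (2 ^ length Ps) (2 ^ length Ps)"
proof (induction Ps)
  case (Cons P Ps)
  then have "kron P (kron_list Ps) \<in> carrier_mat (2 * 2 ^ length Ps) (2 * 2 ^ length Ps)"
    by (intro kron_carrier pauli_carrier) auto
  then show ?case by (simp add: kron_list_def)
qed (simp add: kron_list_def)

lemma kron_list_Cons: "kron_list (P # Ps) = kron P (kron_list Ps)"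
  by (simp add: kron_list_def)

text \<open>The mixed-product rule treats the tensor positions separately; the phases and the
  commutation signs of the positions multiply.\<close>

lemma kron_list_mult:
  assumes "length Ps = length Qs" "set Ps \<subseteq> paulis" "set Qs \<subseteq> paulis"
  shows "\<exists>c \<in> phases. \<exists>s \<in> {1, - 1}. \<exists>Rs. length Rs = length Ps \<and> set Rs \<subseteq> paulis \<and>
    kron_list Ps * kron_list Qs = c \<cdot>\<^sub>m kron_list Rs \<and>
    kron_list Qs * kron_list Ps = (s * c) \<cdot>\<^sub>m kron_list Rs"
  using assms
proof (induction Ps Qs rule: list_induct2)
  case Nil
  have "1\<^sub>m 1 = (1 :: complex) \<cdot>\<^sub>m 1\<^sub>m 1" by (rule eq_matI) auto
  then show ?case
    by (intro bexI[of _ 1] exI[of _ "[]"]) (auto simp: kron_list_def phases_def)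
next
  case (Cons P Ps Q Qs)
  from Cons.prems have sub: "P \<in> paulis" "Q \<in> paulis" "set Ps \<subseteq> paulis" "set Qs \<subseteq> paulis" by auto
  from Cons.IH[OF sub(3,4)] obtain c s Rs where IH: "c \<in> phases" "s \<in> {1, - 1}"
    "length Rs = length Ps" "set Rs \<subseteq> paulis"
    "kron_list Ps * kron_list Qs = c \<cdot>\<^sub>m kron_list Rs"
    "kron_list Qs * kron_list Ps = (s * c) \<cdot>\<^sub>m kron_list Rs" by blast
  from pauli_mult[OF sub(1,2)] obtain d u R where one: "d \<in> phases" "u \<in> {1, - 1}"
    "R \<in> paulis" "P * Q = d \<cdot>\<^sub>m R" "Q * P = (u * d) \<cdot>\<^sub>m R" by blast
  have car: "P \<in> carrier_mat 2 2" "Q \<in> carrier_mat 2 2"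
    "kron_list Ps \<in> carrier_mat (2 ^ length Ps) (2 ^ length Ps)"
    "kron_list Qs \<in> carrier_mat (2 ^ length Ps) (2 ^ length Ps)"
    using sub Cons.hyps kron_list_carrier[of Ps] kron_list_carrier[of Qs] pauli_carrier by auto
  have "kron_list (P # Ps) * kron_list (Q # Qs) = (d * c) \<cdot>\<^sub>m kron_list (R # Rs)"
    by (simp add: kron_list_Cons kron_mult[OF car(1,2,3,4)] one IH kron_smult)
  moreover have "kron_list (Q # Qs) * kron_list (P # Ps) = ((u * s) * (d * c)) \<cdot>\<^sub>m kron_list (R # Rs)"
    by (simp add: kron_list_Cons kron_mult[OF car(2,1,4,3)] one IH kron_smult mult_ac)
  moreover have "d * c \<in> phases" "u * s \<in> {1, - 1}" using one IH by (auto intro: phases_mult)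
  moreover have "length (R # Rs) = length (P # Ps)" "set (R # Rs) \<subseteq> paulis" using one IH by auto
  ultimately show ?case by blast
qed

lemma kron_list_square:
  "set Ps \<subseteq> paulis \<Longrightarrow> kron_list Ps * kron_list Ps = 1\<^sub>m (2 ^ length Ps)"
proof (induction Ps)
  case (Cons P Ps)
  then have car: "P \<in> carrier_mat 2 2" "kron_list Ps \<in> carrier_mat (2 ^ length Ps) (2 ^ length Ps)"
    by (auto intro: pauli_carrier kron_list_carrier)
  have "1 \<cdot>\<^sub>m pauli_I = 1\<^sub>m 2" by (rule eq_matI) (auto simp: pauli_I_eq_one)
  then have "P * P = 1\<^sub>m 2" using Cons.prems by (auto simp: paulis_def pauli_table)
  then show ?case
    using Cons by (simp add: kron_list_Cons kron_mult[OF car(1,1,2,2)] kron_one)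
qed (simp add: kron_list_def)

lemma pauli_ops_eq:
  "pauli_ops N = {s \<cdot>\<^sub>m kron_list Ps | s Ps. s \<in> {1, - 1} \<and> length Ps = N \<and> set Ps \<subseteq> paulis}"
  by (simp add: pauli_ops_def paulis_def)

lemma pauli_opsI:
  "s \<in> {1, - 1} \<Longrightarrow> length Ps = N \<Longrightarrow> set Ps \<subseteq> paulis \<Longrightarrow> s \<cdot>\<^sub>m kron_list Ps \<in> pauli_ops N"
  unfolding pauli_ops_eq by blast

lemma pauli_opsE:
  assumes "A \<in> pauli_ops N"
  obtains s Ps where "s \<in> {1, - 1}" "length Ps = N" "set Ps \<subseteq> paulis" "A = s \<cdot>\<^sub>m kron_list Ps"
  using assms unfolding pauli_ops_eq by blast

lemma pauli_ops_carrier: "A \<in> pauli_ops N \<Longrightarrow> A \<in> carrier_mat (2 ^ N) (2 ^ N)"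
  by (erule pauli_opsE) (use kron_list_carrier in auto)

section \<open>Scalars and commutation signs in matrix products\<close>

lemma smult_smult_times: "s \<cdot>\<^sub>m (t \<cdot>\<^sub>m A) = (s * t) \<cdot>\<^sub>m A"
  for A :: "'a :: semigroup_mult mat"
  by (rule eq_matI) (auto simp: mult.assoc)

lemma smult_mult_smult:
  fixes A B :: "'a :: comm_semiring_1 mat"
  assumes "A \<in> carrier_mat n n" "B \<in> carrier_mat n n"
  shows "(s \<cdot>\<^sub>m A) * (t \<cdot>\<^sub>m B) = (s * t) \<cdot>\<^sub>m (A * B)"
proof -
  have "(s \<cdot>\<^sub>m A) * (t \<cdot>\<^sub>m B) = s \<cdot>\<^sub>m (A * (t \<cdot>\<^sub>m B))"
    using assms by (intro mult_smult_assoc_mat) auto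
  also have "A * (t \<cdot>\<^sub>m B) = t \<cdot>\<^sub>m (A * B)"
    using assms by (intro mult_smult_distrib) auto
  finally show ?thesis by (simp add: smult_smult_times)
qed

lemma one_smult_mat [simp]: "(1 :: complex) \<cdot>\<^sub>m A = A"
  by (rule eq_matI) auto

lemma pauli_ops_square:
  assumes "A \<in> pauli_ops N"
  shows "A * A = 1\<^sub>m (2 ^ N)"
proof -
  from assms obtain s Ps where A: "s \<in> {1, - 1}" "length Ps = N" "set Ps \<subseteq> paulis"
    "A = s \<cdot>\<^sub>m kron_list Ps" by (rule pauli_opsE)
  have "A * A = (s * s) \<cdot>\<^sub>m 1\<^sub>m (2 ^ N)"
    using A kron_list_carrier[OF A(3)] kron_list_square[OF A(3)] by (simp only: smult_mult_smult)
  then show ?thesis using A(1) by auto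
qed

text \<open>Moving \<open>C\<close> to the left past \<open>B\<close> and then past \<open>A\<close>
  collects both scalars. With scalars 1 and -1 this single computation yields all four sign rules of
  \<open>commute_mult\<close>.\<close>

lemma mult_swap_phase:
  fixes A B C :: "'a :: comm_semiring_1 mat"
  assumes [simp]: "A \<in> carrier_mat n n" "B \<in> carrier_mat n n" "C \<in> carrier_mat n n"
    and AC: "A * C = s \<cdot>\<^sub>m (C * A)" and BC: "B * C = t \<cdot>\<^sub>m (C * B)"
  shows "(A * B) * C = (s * t) \<cdot>\<^sub>m (C * (A * B))"
proof -
  have "(A * B) * C = A * (t \<cdot>\<^sub>m (C * B))"
    using BC assoc_mult_mat[of A n n B n C n] by simp
  also have "\<dots> = t \<cdot>\<^sub>m (A * (C * B))"
    by (intro mult_smult_distrib[of _ n n _ n] mult_carrier_mat[of _ n n]) simp_all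
  also have "A * (C * B) = (s \<cdot>\<^sub>m (C * A)) * B"
    using AC assoc_mult_mat[of A n n C n B n] by simp
  also have "\<dots> = s \<cdot>\<^sub>m ((C * A) * B)"
    by (intro mult_smult_assoc_mat[of _ n n _ n] mult_carrier_mat[of _ n n]) simp_all
  also have "(C * A) * B = C * (A * B)"
    using assoc_mult_mat[of C n n A n B n] by simp
  finally show ?thesis by (simp add: smult_smult_times mult.commute)
qed

lemma commute_sym: "commute A B \<Longrightarrow> commute B A"
  by (simp add: commute_def)

lemma commute_refl: "commute A A"
  by (simp add: commute_def)

lemma anticommute_iff: "anticommute A B \<longleftrightarrow> A * B = (- 1) \<cdot>\<^sub>m (B * A)"
proof -
  have "(- 1) \<cdot>\<^sub>m (B * A) = - (B * A)" by (rule eq_matI) auto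
  then show ?thesis by (simp add: anticommute_def)
qed

lemma anticommute_sym: "anticommute A B \<Longrightarrow> anticommute B A"
  by (simp add: anticommute_def)

lemma commute_iff_phase: "commute A B \<longleftrightarrow> A * B = 1 \<cdot>\<^sub>m (B * A)"
  by (simp add: commute_def)

lemma commute_mult:
  assumes "A \<in> carrier_mat n n" "B \<in> carrier_mat n n" "C \<in> carrier_mat n n"
  shows "commute A C \<Longrightarrow> commute B C \<Longrightarrow> commute (A * B) C"
    and "anticommute A C \<Longrightarrow> anticommute B C \<Longrightarrow> commute (A * B) C"
    and "commute A C \<Longrightarrow> anticommute B C \<Longrightarrow> anticommute (A * B) C"
    and "anticommute A C \<Longrightarrow> commute B C \<Longrightarrow> anticommute (A * B) C"
  using mult_swap_phase[OF assms] unfolding commute_iff_phase anticommute_iff by fastforce+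

lemma pauli_ops_commute_or_anticommute:
  assumes "A \<in> pauli_ops N" "B \<in> pauli_ops N"
  shows "commute A B \<or> anticommute A B"
proof -
  from assms(1) obtain s Ps where A: "s \<in> {1, - 1}" "length Ps = N" "set Ps \<subseteq> paulis"
    "A = s \<cdot>\<^sub>m kron_list Ps" by (rule pauli_opsE)
  from assms(2) obtain t Qs where B: "t \<in> {1, - 1}" "length Qs = N" "set Qs \<subseteq> paulis"
    "B = t \<cdot>\<^sub>m kron_list Qs" by (rule pauli_opsE)
  have "length Ps = length Qs" using A B by simp
  from kron_list_mult[OF this A(3) B(3)] obtain c u Rs where R: "u \<in> {1, - 1}"
    "kron_list Ps * kron_list Qs = c \<cdot>\<^sub>m kron_list Rs"
    "kron_list Qs * kron_list Ps = (u * c) \<cdot>\<^sub>m kron_list Rs" by blast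
  note car = kron_list_carrier[OF A(3), unfolded A(2)] kron_list_carrier[OF B(3), unfolded B(2)]
  have "A * B = (s * t * c) \<cdot>\<^sub>m kron_list Rs"
    unfolding A(4) B(4) by (simp add: smult_mult_smult[OF car] R smult_smult_times)
  moreover have "B * A = (s * t * u * c) \<cdot>\<^sub>m kron_list Rs"
    unfolding A(4) B(4) by (simp add: smult_mult_smult[OF car(2,1)] R smult_smult_times mult_ac)
  \<comment> \<open>The sign \<open>u\<close> sits in \<open>B * A\<close>; since it squares to 1,
    it can be moved to the other side.\<close>
  moreover have "u * u = 1" using R(1) by auto
  ultimately have "A * B = u \<cdot>\<^sub>m (B * A)" by (simp add: smult_smult_times mult_ac)
  then show ?thesis using R(1) unfolding commute_iff_phase anticommute_iff by auto
qed

text \<open>A priori the product carries a phase that may be imaginary. As the factors commute, the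
  product squares to the identity, so the phase squares to 1 and is a sign.\<close>

lemma pauli_ops_mult:
  assumes "A \<in> pauli_ops N" "B \<in> pauli_ops N" "commute A B"
  shows "A * B \<in> pauli_ops N"
proof -
  from assms(1) obtain s Ps where A: "s \<in> {1, - 1}" "length Ps = N" "set Ps \<subseteq> paulis"
    "A = s \<cdot>\<^sub>m kron_list Ps" by (rule pauli_opsE)
  from assms(2) obtain t Qs where B: "t \<in> {1, - 1}" "length Qs = N" "set Qs \<subseteq> paulis"
    "B = t \<cdot>\<^sub>m kron_list Qs" by (rule pauli_opsE)
  have "length Ps = length Qs" using A B by simp
  from kron_list_mult[OF this A(3) B(3)] A(2) obtain c Rs where R: "length Rs = N" "set Rs \<subseteq> paulis"
    "kron_list Ps * kron_list Qs = c \<cdot>\<^sub>m kron_list Rs" by blast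
  note car = kron_list_carrier[OF A(3), unfolded A(2)] kron_list_carrier[OF B(3), unfolded B(2)]
  have AB: "A * B = (s * t * c) \<cdot>\<^sub>m kron_list Rs"
    unfolding A(4) B(4) by (simp add: smult_mult_smult[OF car] R smult_smult_times)
  note [simp] = assms(1,2)[THEN pauli_ops_carrier]
  have "(A * B) * (A * B) = A * (B * (B * A))"
    using assms(3) assoc_mult_mat[of A "2 ^ N" "2 ^ N" B "2 ^ N" "B * A" "2 ^ N"]
      mult_carrier_mat[of B "2 ^ N" "2 ^ N" A "2 ^ N"]
    by (simp add: commute_def)
  also have "B * (B * A) = A"
    using assoc_mult_mat[of B "2 ^ N" "2 ^ N" B "2 ^ N" A "2 ^ N"] pauli_ops_square[OF assms(2)]
    by (metis assms(1,2) left_mult_one_mat pauli_ops_carrier)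
  finally have "1\<^sub>m (2 ^ N) = (A * B) * (A * B)" by (simp only: pauli_ops_square[OF assms(1)])
  also have "\<dots> = (s * t * c)\<^sup>2 \<cdot>\<^sub>m 1\<^sub>m (2 ^ N)"
    unfolding AB using kron_list_carrier[OF R(2)] kron_list_square[OF R(2)] R(1)
    by (simp only: smult_mult_smult power2_eq_square)
  finally have "1\<^sub>m (2 ^ N) $$ (0, 0) = ((s * t * c)\<^sup>2 \<cdot>\<^sub>m 1\<^sub>m (2 ^ N)) $$ (0, 0)"
    by (rule arg_cong)
  then have "(s * t * c)\<^sup>2 = 1" by simp
  then have "s * t * c \<in> {1, - 1}" by (simp only: power2_eq_1_iff insert_iff empty_iff simp_thms)
  then show ?thesis unfolding AB using R by (intro pauli_opsI)
qed

text \<open>The dimension \<open>2 ^ N\<close> is positive, so there is an entry at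
  \<open>(0, 0)\<close>, where 1 differs from -1.\<close>

lemma one_neq_uminus_one_mat: "1\<^sub>m (2 ^ N) \<noteq> - (1\<^sub>m (2 ^ N) :: complex mat)"
proof
  assume "1\<^sub>m (2 ^ N) = - (1\<^sub>m (2 ^ N) :: complex mat)"
  then have "1\<^sub>m (2 ^ N) $$ (0, 0) = (- (1\<^sub>m (2 ^ N) :: complex mat)) $$ (0, 0)" by simp
  then show False by simp
qed

text \<open>If both relations held, \<open>A * B\<close> would equal its own negative. Multiplying
  by its left inverse \<open>B * A\<close> would then identify the identity matrix with its
  negative.\<close>

lemma pauli_ops_anticommute_iff:
  assumes "A \<in> pauli_ops N" "B \<in> pauli_ops N"
  shows "anticommute A B \<longleftrightarrow> \<not> commute A B"
proof -
  note car = assms[THEN pauli_ops_carrier]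
  note car' = mult_carrier_mat[OF car] mult_carrier_mat[OF car(2,1)]
  have False if AB: "anticommute A B" "commute A B"
  proof -
    have "(B * A) * (A * B) = ((B * A) * A) * B"
      using assoc_mult_mat[OF car'(2) car] by (rule sym)
    also have "(B * A) * A = B"
      unfolding assoc_mult_mat[OF car(2,1,1)] pauli_ops_square[OF assms(1)]
      by (rule right_mult_one_mat[OF car(2)])
    finally have one: "(B * A) * (A * B) = 1\<^sub>m (2 ^ N)"
      unfolding pauli_ops_square[OF assms(2)] .
    from AB have "A * B = - (A * B)" unfolding anticommute_def commute_def by metis
    then have "(B * A) * (A * B) = (B * A) * - (A * B)" by (rule arg_cong)
    also have "\<dots> = - ((B * A) * (A * B))" using car by (intro uminus_mult_right_mat) auto
    finally show False unfolding one using one_neq_uminus_one_mat by contradiction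
  qed
  with pauli_ops_commute_or_anticommute[OF assms] show ?thesis by blast
qed

section \<open>A triple yields a Peres-Mermin square\<close>

lemma determining_tree_root: "determining_tree N S t \<Longrightarrow> root t \<in> pauli_ops N"
  by (induction rule: determining_tree.induct) auto

abbreviation node2 :: "complex mat rtree \<Rightarrow> complex mat rtree \<Rightarrow> complex mat rtree" where
  "node2 t u \<equiv> Node (root t * root u) [t, u]"

lemma determining_tree_node2:
  assumes t: "determining_tree N S t" and u: "determining_tree N S u"
    and c: "commute (root t) (root u)"
  shows "determining_tree N S (node2 t u)"
proof (rule determining_tree.parent)
  note p = t[THEN determining_tree_root] u[THEN determining_tree_root]
  show "root t * root u \<in> pauli_ops N" using p c by (rule pauli_ops_mult)
  have "root u * 1\<^sub>m (2 ^ N) = root u" using pauli_ops_carrier[OF p(2)] by (rule right_mult_one_mat)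
  then show "root t * root u = op_prod N (map root [t, u])" by (simp add: op_prod_def)
  show "\<forall>v \<in> set [t, u]. \<forall>w \<in> set [t, u]. commute (root v) (root w)"
    using c by (auto simp: commute_refl commute_sym)
qed (use t u in auto)

text \<open>The operators form a 4-cycle \<open>A\<close>, \<open>B\<close>, \<open>D\<close>,
  \<open>C\<close>: neighbours commute and opposite ones anticommute. Pairing neighbours in the two
  possible ways gives trees with the same leaves, and exchanging the middle factors \<open>B\<close>
  and \<open>C\<close> costs a sign. The corners are trees rather than members of \<open>S\<close>,
  so that products of commuting members may stand there.\<close>

lemma contextual_square:
  assumes tree: "determining_tree N S tA" "determining_tree N S tB"
      "determining_tree N S tC" "determining_tree N S tD"
    and c: "commute (root tA) (root tB)" "commute (root tA) (root tC)"
      "commute (root tB) (root tD)" "commute (root tC) (root tD)"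
    and a: "anticommute (root tA) (root tD)" "anticommute (root tB) (root tC)"
  shows "contextual N S"
proof -
  let ?n = "2 ^ N :: nat"
  define A B C D where ABCD: "A = root tA" "B = root tB" "C = root tC" "D = root tD"
  note p = tree[THEN determining_tree_root, folded ABCD]
  note [simp] = p[THEN pauli_ops_carrier]
  note c' = c[folded ABCD] and a' = a[folded ABCD]
  have [simp]: "X * Y \<in> carrier_mat ?n ?n" if "X \<in> carrier_mat ?n ?n" "Y \<in> carrier_mat ?n ?n" for X Y :: "complex mat"
    using that by (rule mult_carrier_mat)
  \<comment> \<open>Two of the four cross pairs anticommute, and their signs cancel.\<close>
  have square: "commute (W * X) (Y * Z)"
    if "W \<in> carrier_mat ?n ?n" "X \<in> carrier_mat ?n ?n" "Y \<in> carrier_mat ?n ?n" "Z \<in> carrier_mat ?n ?n"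
      "commute W Y" "commute X Z" "anticommute W Z" "anticommute X Y" for W X Y Z :: "complex mat"
  proof -
    have "anticommute (W * X) Y" "anticommute (W * X) Z"
      using that by (auto intro: commute_mult)
    then have "commute (Y * Z) (W * X)"
      using that anticommute_sym[of "W * X"] by (intro commute_mult(2)[of Y ?n Z "W * X"]) auto
    then show ?thesis by (rule commute_sym)
  qed
  let ?t = "node2 (node2 tA tB) (node2 tC tD)" and ?u = "node2 (node2 tA tC) (node2 tB tD)"
  have "commute (A * B) (C * D)" "commute (A * C) (B * D)"
    using c' a' anticommute_sym[OF a'(2)] by (simp_all add: square)
  then have "determining_tree N S ?t" "determining_tree N S ?u"
    using determining_tree_node2[OF determining_tree_node2[OF tree(1,2) c(1)]
        determining_tree_node2[OF tree(3,4) c(4)]]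
      determining_tree_node2[OF determining_tree_node2[OF tree(1,3) c(2)]
        determining_tree_node2[OF tree(2,4) c(3)]]
    by (simp_all add: ABCD)
  moreover have "root ?u = - root ?t"
  proof -
    \<comment> \<open>Rebracketing puts \<open>B\<close> and \<open>C\<close> next to each other,
      where swapping them produces the sign.\<close>
    have assoc: "(W * X) * (Y * Z) = W * ((X * Y) * Z)"
      if "W \<in> carrier_mat ?n ?n" "X \<in> carrier_mat ?n ?n" "Y \<in> carrier_mat ?n ?n" "Z \<in> carrier_mat ?n ?n"
      for W X Y Z :: "complex mat"
      using that by (simp add: assoc_mult_mat[of _ ?n ?n _ ?n _ ?n])
    have "B * C = - (C * B)" using a'(2) by (simp only: anticommute_def)
    moreover have "- (C * B) * D = - ((C * B) * D)"
      using p(4)[THEN pauli_ops_carrier] mult_carrier_mat[OF p(3,2)[THEN pauli_ops_carrier]]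
      by (intro uminus_mult_left_mat) (simp only: carrier_matD)
    moreover have "A * - ((C * B) * D) = - (A * ((C * B) * D))"
      using p(1)[THEN pauli_ops_carrier]
        mult_carrier_mat[OF mult_carrier_mat[OF p(3,2)[THEN pauli_ops_carrier]] p(4)[THEN pauli_ops_carrier]]
      by (intro uminus_mult_right_mat) (simp only: carrier_matD)
    ultimately have "(A * B) * (C * D) = - ((A * C) * (B * D))" by (simp add: assoc)
    then show ?thesis by (simp add: ABCD)
  qed
  moreover have "determining_set ?t = determining_set ?u"
    by (simp add: determining_set_def add_ac)
  ultimately have "root ?t \<in> pauli_ops N" "determining_tree_for N S (root ?t) ?t"
    "determining_tree_for N S (- root ?t) ?u" "determining_set ?t = determining_set ?u"
    by (simp_all only: determining_tree_for_def determining_tree_root simp_thms)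
  then show ?thesis unfolding contextual_def by blast
qed

theorem contextual_if_triple:
  assumes S: "S \<subseteq> pauli_ops N" and mem: "A \<in> S" "B \<in> S" "C \<in> S" "D \<in> S"
    and AB: "commute A B" and AC: "commute A C" and BC: "anticommute B C" and AD: "anticommute A D"
  shows "contextual N S"
proof -
  let ?n = "2 ^ N :: nat"
  have p: "X \<in> pauli_ops N" if "X \<in> S" for X using that S by blast
  have leaf: "determining_tree N S (Node X [])" if "X \<in> S" for X
    using that p by (intro determining_tree.leaf)
  have leaf2: "determining_tree N S (Node (X * Y) [Node X [], Node Y []])"
    if "X \<in> S" "Y \<in> S" "commute X Y" for X Y
    using determining_tree_node2[OF leaf[OF that(1)] leaf[OF that(2)]] that(3) by simp
  have car[simp]: "X \<in> carrier_mat ?n ?n" if "X \<in> S" for X using that p pauli_ops_carrier by blast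
  note cm = commute_mult[of _ ?n]
  note [simp] = mem
  \<comment> \<open>Here \<open>D\<close> commutes with exactly one of the anticommuting pair,
    namely \<open>E\<close>. Replacing \<open>D\<close> by \<open>D * E\<close> flips the sign
    against \<open>F\<close> and keeps those against \<open>A\<close> and \<open>E\<close>.\<close>
  have path_case: ?thesis
    if E: "E \<in> S" "F \<in> S" "commute A E" "commute A F" "anticommute E F" "commute D E" "anticommute D F"
    for E F
  proof -
    have "commute (D * E) F" "anticommute (D * E) A" "commute (D * E) E"
      using that commute_sym[of A E] anticommute_sym[OF AD] commute_refl[of E]
      by (auto intro: cm)
    then show ?thesis
      using that mem anticommute_sym[of "D * E" A] commute_sym[of "D * E"]
      by (intro contextual_square[of N S "Node A []" "Node E []" "Node F []" "node2 (Node D []) (Node E [])"])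
         (simp_all add: leaf leaf2)
  qed
  consider "commute D B" "commute D C" | "commute D B" "anticommute D C"
    | "anticommute D B" "commute D C" | "anticommute D B" "anticommute D C"
    using mem pauli_ops_commute_or_anticommute p by blast
  then show ?thesis
  proof cases
    case 1
    then show ?thesis
      using AB AC BC AD mem commute_sym[of D]
      by (intro contextual_square[of N S "Node A []" "Node B []" "Node C []" "Node D []"])
         (simp_all add: leaf)
  next
    case 2
    then show ?thesis using path_case[of B C] AB AC BC by simp
  next
    case 3
    then show ?thesis using path_case[of C B] AB AC BC by (simp add: anticommute_sym)
  next
    case 4
    \<comment> \<open>Now \<open>D\<close> anticommutes with \<open>A\<close>, \<open>B\<close> and
      \<open>C\<close>. Multiplying \<open>B\<close> and \<open>C\<close> by \<open>A\<close> makes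
      them commute with \<open>D\<close>; as \<open>A\<close> commutes with both, the products still
      commute with \<open>A\<close> and anticommute with each other.\<close>
    note A = commute_sym[OF AB] commute_sym[OF AC] anticommute_sym[OF AD] commute_refl[of A]
    have [simp]: "A * B \<in> carrier_mat ?n ?n" "A * C \<in> carrier_mat ?n ?n"
      by (intro mult_carrier_mat[of _ ?n ?n]; simp)+
    have "commute (A * B) A" "commute (A * C) A" "commute (A * B) D" "commute (A * C) D"
      using A AD 4 anticommute_sym[of D] by (auto intro: cm)
    moreover have "anticommute (A * C) (A * B)"
    proof (rule cm(3))
      show "commute A (A * B)" using \<open>commute (A * B) A\<close> by (rule commute_sym)
      have "anticommute (A * B) C" using AC BC by (auto intro: cm)
      then show "anticommute C (A * B)" by (rule anticommute_sym)
    qed simp_all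
    ultimately show ?thesis
      using AB AC AD mem commute_sym[of _ A] anticommute_sym[of "A * C"]
      by (intro contextual_square[of N S "Node A []" "node2 (Node A []) (Node B [])"
            "node2 (Node A []) (Node C [])" "Node D []"])
         (simp_all add: leaf leaf2)
  qed
qed

section \<open>Without a triple the leaves determine the root\<close>

text \<open>The head of a nonempty list of this kind occurs again in its tail. Deleting both copies
  leaves a shorter list of the same kind.\<close>

lemma even_count_induct [consumes 1, case_names Nil pair]:
  assumes "\<And>x. even (count_list xs x)"
    and "P []"
    and "\<And>x ys zs. P (ys @ zs) \<Longrightarrow> P (x # ys @ x # zs)"
  shows "P xs"
  using assms(1)
proof (induction xs rule: length_induct)
  case (1 xs)
  show ?case
  proof (cases xs)
    case Nil
    then show ?thesis using assms(2) by simp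
  next
    case (Cons x us)
    have "odd (count_list us x)" using 1(2)[of x] Cons by simp
    then have "x \<in> set us" by (cases "x \<in> set us") auto
    then obtain ys zs where us: "us = ys @ x # zs" by (auto simp: in_set_conv_decomp)
    have "even (count_list (ys @ zs) y)" for y
      using 1(2)[of y] by (auto simp: Cons us split: if_splits)
    then have "P (ys @ zs)" using 1(1) by (simp add: Cons us)
    then show ?thesis using assms(3) by (simp add: Cons us)
  qed
qed

lemma even_length_filter_if_even_counts:
  "(\<And>x. even (count_list xs x)) \<Longrightarrow> even (length (filter P xs))"
  by (induction xs rule: even_count_induct) (auto)

section \<open>Ordered products of commuting matrices\<close>

lemma op_prod_Nil [simp]: "op_prod N [] = 1\<^sub>m (2 ^ N)"
  and op_prod_Cons: "op_prod N (A # As) = A * op_prod N As"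
  by (simp_all add: op_prod_def)

lemma op_prod_carrier:
  "set As \<subseteq> carrier_mat (2 ^ N) (2 ^ N) \<Longrightarrow> op_prod N As \<in> carrier_mat (2 ^ N) (2 ^ N)"
  by (induction As) (auto simp: op_prod_Cons intro!: mult_carrier_mat)

lemma op_prod_append:
  assumes "set As \<subseteq> carrier_mat (2 ^ N) (2 ^ N)" "set Bs \<subseteq> carrier_mat (2 ^ N) (2 ^ N)"
  shows "op_prod N (As @ Bs) = op_prod N As * op_prod N Bs"
  using assms(1)
proof (induction As)
  case Nil
  then show ?case using left_mult_one_mat[OF op_prod_carrier[OF assms(2)]] by simp
next
  case (Cons A As)
  then have "A \<in> carrier_mat (2 ^ N) (2 ^ N)" "op_prod N As \<in> carrier_mat (2 ^ N) (2 ^ N)"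
    using op_prod_carrier[of As N] by auto
  then show ?case
    using Cons assoc_mult_mat[OF _ _ op_prod_carrier[OF assms(2)]] by (simp add: op_prod_Cons)
qed

lemma commute_one: "A \<in> carrier_mat n n \<Longrightarrow> commute A (1\<^sub>m n)"
  by (simp add: commute_def)

lemma commute_op_prod:
  assumes "set As \<subseteq> carrier_mat (2 ^ N) (2 ^ N)" "B \<in> carrier_mat (2 ^ N) (2 ^ N)"
    and "\<And>A. A \<in> set As \<Longrightarrow> commute A B"
  shows "commute (op_prod N As) B"
  using assms(1,3)
proof (induction As)
  case Nil
  then show ?case using commute_sym[OF commute_one[OF assms(2)]] by simp
next
  case (Cons A As)
  then show ?case unfolding op_prod_Cons
    by (intro commute_mult(1)[of A "2 ^ N" "op_prod N As" B] op_prod_carrier assms(2)) auto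
qed

text \<open>The second copy of \<open>A\<close> slides past the commuting factors to the first one,
  and the two cancel.\<close>

lemma op_prod_even_counts:
  assumes "\<And>x. even (count_list As x)" "set As \<subseteq> carrier_mat (2 ^ N) (2 ^ N)"
    and "\<And>A B. A \<in> set As \<Longrightarrow> B \<in> set As \<Longrightarrow> commute A B"
    and "\<And>A. A \<in> set As \<Longrightarrow> A * A = 1\<^sub>m (2 ^ N)"
  shows "op_prod N As = 1\<^sub>m (2 ^ N)"
  using assms
proof (induction As rule: even_count_induct)
  case (pair A As Bs)
  then have car: "A \<in> carrier_mat (2 ^ N) (2 ^ N)" "set As \<subseteq> carrier_mat (2 ^ N) (2 ^ N)"
     "set Bs \<subseteq> carrier_mat (2 ^ N) (2 ^ N)" by auto
  let ?P = "op_prod N As" and ?Q = "op_prod N Bs"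
  note car' = car(1) op_prod_carrier[OF car(2)] op_prod_carrier[OF car(3)]
  have comm: "commute ?P A" using car pair.prems by (intro commute_op_prod) auto
  have "op_prod N (A # As @ A # Bs) = A * (?P * (A * ?Q))"
    using car by (simp add: op_prod_Cons op_prod_append)
  also have "?P * (A * ?Q) = A * (?P * ?Q)"
    unfolding assoc_mult_mat[OF car'(2,1,3), symmetric] comm[unfolded commute_def]
      assoc_mult_mat[OF car'(1,2,3)] ..
  also have "A * (A * (?P * ?Q)) = (A * A) * (?P * ?Q)"
    using assoc_mult_mat[OF car(1) car(1) mult_carrier_mat[OF car'(2,3)]] by (rule sym)
  also have "?P * ?Q = op_prod N (As @ Bs)" using car by (simp add: op_prod_append)
  also have "\<dots> = 1\<^sub>m (2 ^ N)" using pair by auto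
  also have "A * A = 1\<^sub>m (2 ^ N)" using pair.prems by auto
  finally show ?case by simp
qed simp

text \<open>The case without a triple. The assumption \<open>trans\<close> excludes triples in which
  \<open>B\<close> commutes with both others; together with reflexivity and symmetry it makes
  commutation an equivalence relation on \<open>T\<close>.\<close>

locale commutation_classes =
  fixes N :: nat and S T :: "complex mat set"
  assumes pauli: "S \<subseteq> pauli_ops N"
    and T: "T = {A \<in> S. \<exists>B \<in> S. \<not> commute A B}"
    and trans: "A \<in> T \<Longrightarrow> B \<in> T \<Longrightarrow> C \<in> T \<Longrightarrow> commute A B \<Longrightarrow> commute B C \<Longrightarrow> commute A C"
begin

section \<open>Representatives of the commutation classes\<close>

abbreviation M :: "complex mat set" where
  "M \<equiv> carrier_mat (2 ^ N) (2 ^ N)"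

abbreviation one :: "complex mat" where
  "one \<equiv> 1\<^sub>m (2 ^ N)"

text \<open>For \<open>A\<close> in \<open>T\<close> the choice depends only on the class of
  \<open>A\<close>. The default \<open>one\<close> makes \<open>shifted\<close> leave the central
  operators of \<open>S\<close> unchanged.\<close>

definition rep :: "complex mat \<Rightarrow> complex mat" where
  "rep A = (if A \<in> T then SOME B. B \<in> T \<and> commute A B else one)"

definition shifted :: "complex mat \<Rightarrow> complex mat" where
  "shifted A = A * rep A"

lemma S_carrier: "A \<in> S \<Longrightarrow> A \<in> M"
  using pauli pauli_ops_carrier by blast

lemma S_square: "A \<in> S \<Longrightarrow> A * A = one"
  using pauli pauli_ops_square by blast

lemma S_anticommute: "A \<in> S \<Longrightarrow> B \<in> S \<Longrightarrow> anticommute A B \<longleftrightarrow> \<not> commute A B"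
  using pauli pauli_ops_anticommute_iff by blast

lemma T_subset: "T \<subseteq> S"
  using T by blast

lemma rep_T: "A \<in> T \<Longrightarrow> rep A \<in> T \<and> commute A (rep A)"
  unfolding rep_def using someI[of "\<lambda>B. B \<in> T \<and> commute A B" A] commute_refl[of A] by simp

lemma rep_carrier: "rep A \<in> M"
  using rep_T[of A] T_subset S_carrier by (cases "A \<in> T") (auto simp: rep_def)

lemma rep_square: "rep A * rep A = one"
  using rep_T[of A] T_subset S_square by (cases "A \<in> T") (auto simp: rep_def)

lemma commute_rep: "A \<in> S \<Longrightarrow> commute A (rep A)"
  using rep_T[of A] S_carrier by (cases "A \<in> T") (auto simp: rep_def commute_one)

text \<open>Transitivity along \<open>A\<close>, \<open>rep A\<close>, \<open>rep B\<close>,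
  \<open>B\<close> places \<open>A\<close> and \<open>B\<close> in one class, so both choices are
  made by equivalent predicates. In a product of commuting operators this prevents two different
  representatives from surviving.\<close>

lemma rep_eq:
  assumes "A \<in> T" "B \<in> T" "commute (rep A) (rep B)"
  shows "rep A = rep B"
proof -
  have "commute A B"
    using assms rep_T[of A] rep_T[of B] trans[of A "rep A" "rep B"] trans[of A "rep B" B] commute_sym
    by blast
  then have "C \<in> T \<and> commute A C \<longleftrightarrow> C \<in> T \<and> commute B C" for C
    using assms(1,2) trans[of A B C] trans[of B A C] commute_sym by blast
  then show ?thesis using assms by (simp add: rep_def)
qed

text \<open>The representative is noncentral, whereas the identity commutes with everything in
  \<open>S\<close>. Hence \<open>one\<close> can mark the absence of a class.\<close>

lemma rep_neq_one: "A \<in> T \<Longrightarrow> rep A \<noteq> one"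
  using rep_T[of A] T commute_one commute_sym S_carrier by fastforce

lemma shifted_carrier: "A \<in> S \<Longrightarrow> shifted A \<in> M"
  unfolding shifted_def using S_carrier rep_carrier by (rule mult_carrier_mat)

text \<open>An operator and the representative of its class have the same sign of commutation with
  every member of \<open>S\<close>, so the signs cancel.\<close>

lemma shifted_commute:
  assumes "A \<in> S" "B \<in> S"
  shows "commute (shifted A) B"
proof (cases "A \<in> T")
  case True
  then have R: "rep A \<in> T" "rep A \<in> S" "commute A (rep A)" using rep_T T_subset by blast+
  have "commute A B \<longleftrightarrow> commute (rep A) B"
  proof (cases "B \<in> T")
    case True
    with \<open>A \<in> T\<close> R show ?thesis
      using trans[of A "rep A" B] trans[of "rep A" A B] commute_sym by blast
  next
    case False
    then show ?thesis using assms R T commute_sym by blast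
  qed
  then show ?thesis
    unfolding shifted_def using commute_mult(1,2)[OF S_carrier[OF assms(1)] rep_carrier S_carrier[OF assms(2)]]
      S_anticommute[OF assms] S_anticommute[OF R(2) assms(2)] by blast
next
  case False
  then have "commute A B" using assms T by blast
  moreover have "shifted A = A"
    using False S_carrier[OF assms(1)] by (simp add: shifted_def rep_def)
  ultimately show ?thesis by simp
qed

text \<open>The possible values of the factor that remains once the shifted operators are split off:
  one representative, or the identity if none survives.\<close>

definition residues :: "complex mat set" where
  "residues = insert one (rep ` T)"

lemma rep_residue: "rep A \<in> residues"
  by (cases "A \<in> T") (auto simp: residues_def rep_def)

lemma residue_cases: "\<rho> \<in> residues \<Longrightarrow> \<rho> = one \<or> \<rho> \<in> S"
  using rep_T T_subset unfolding residues_def by blast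

lemma residue_carrier: "\<rho> \<in> residues \<Longrightarrow> \<rho> \<in> M"
  using residue_cases S_carrier by fastforce

lemma residue_square: "\<rho> \<in> residues \<Longrightarrow> \<rho> * \<rho> = one"
  using residue_cases S_square by fastforce

lemma shifted_commute_residue:
  assumes "A \<in> S" "\<rho> \<in> residues"
  shows "commute (shifted A) \<rho>"
  using residue_cases[OF assms(2)] shifted_commute[OF assms(1)] commute_one[OF shifted_carrier[OF assms(1)]]
  by blast

lemma shifted_commute_shifted:
  assumes "A \<in> S" "B \<in> S"
  shows "commute (shifted A) (shifted B)"
proof -
  have "commute (B * rep B) (shifted A)"
    using assms shifted_commute commute_sym shifted_commute_residue[OF assms(1) rep_residue]
    by (intro commute_mult(1)[of B "2 ^ N"] S_carrier rep_carrier shifted_carrier) auto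
  then show ?thesis unfolding shifted_def[of B] by (rule commute_sym)
qed

lemma shifted_square:
  assumes "A \<in> S"
  shows "shifted A * shifted A = one"
proof -
  note car = S_carrier[OF assms] rep_carrier[of A]
  have "shifted A * shifted A = (A * rep A) * (rep A * A)"
    using commute_rep[OF assms] by (simp add: shifted_def commute_def)
  also have "\<dots> = A * ((rep A * rep A) * A)"
    using assoc_mult_mat[OF car mult_carrier_mat[OF car(2,1)]] assoc_mult_mat[OF car(2,2,1)] by simp
  also have "\<dots> = one" using car S_square[OF assms] by (simp add: rep_square)
  finally show ?thesis .
qed

section \<open>Products of shifted operators\<close>

definition central_part :: "complex mat list \<Rightarrow> complex mat" where
  "central_part L = op_prod N (map shifted L)"

lemma map_shifted_carrier: "set L \<subseteq> S \<Longrightarrow> set (map shifted L) \<subseteq> M"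
  using shifted_carrier by auto

lemma central_part_carrier: "set L \<subseteq> S \<Longrightarrow> central_part L \<in> M"
  unfolding central_part_def by (intro op_prod_carrier map_shifted_carrier)

lemma central_part_append:
  "set L \<subseteq> S \<Longrightarrow> set L' \<subseteq> S \<Longrightarrow> central_part (L @ L') = central_part L * central_part L'"
  unfolding central_part_def map_append by (intro op_prod_append map_shifted_carrier)

lemma central_part_commute_residue:
  "set L \<subseteq> S \<Longrightarrow> \<rho> \<in> residues \<Longrightarrow> commute (central_part L) \<rho>"
  unfolding central_part_def
  by (intro commute_op_prod map_shifted_carrier residue_carrier)
     (auto intro: shifted_commute_residue)

lemma central_part_commute:
  assumes "set L \<subseteq> S" "set L' \<subseteq> S"
  shows "commute (central_part L) (central_part L')"
  unfolding central_part_def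
proof (rule commute_op_prod[OF map_shifted_carrier[OF assms(1)]])
  show "op_prod N (map shifted L') \<in> M" using assms(2) by (intro op_prod_carrier map_shifted_carrier)
  fix A assume "A \<in> set (map shifted L)"
  then obtain B where B: "B \<in> S" "A = shifted B" using assms by auto
  have "commute (op_prod N (map shifted L')) A"
    using assms B shifted_commute_shifted shifted_carrier
    by (intro commute_op_prod map_shifted_carrier) auto
  then show "commute A (op_prod N (map shifted L'))" by (rule commute_sym)
qed

text \<open>A sum of even multiplicities is even. This matters because \<open>shifted\<close> can
  merge operators: it sends every representative to the identity.\<close>

lemma even_count_map:
  assumes "\<And>x. even (count_list xs x)"
  shows "even (count_list (map f xs) y)"
  using even_length_filter_if_even_counts[OF assms, of "\<lambda>x. y = f x"]
  by (simp add: count_list_eq_length_filter filter_map o_def)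

lemma central_part_even_counts:
  assumes "set L \<subseteq> S" "\<And>A. even (count_list L A)"
  shows "central_part L = one"
  unfolding central_part_def
proof (rule op_prod_even_counts[OF even_count_map[OF assms(2)] map_shifted_carrier[OF assms(1)]])
  fix A B assume "A \<in> set (map shifted L)" "B \<in> set (map shifted L)"
  then obtain A' B' where "A' \<in> S" "B' \<in> S" "A = shifted A'" "B = shifted B'"
    using assms(1) by auto
  then show "commute A B" "A * A = one" by (simp_all add: shifted_commute_shifted shifted_square)
qed

section \<open>The invariant carried from the leaves to the root\<close>

definition class_count :: "complex mat \<Rightarrow> complex mat list \<Rightarrow> nat" where
  "class_count \<rho> L = length (filter (\<lambda>A. rep A = \<rho>) L)"

text \<open>The invariant for a node \<open>A\<close> with leaves \<open>L\<close>. By the parity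
  condition \<open>\<rho>\<close> is the representative of the only class with an odd number of
  leaves, or \<open>one\<close> if there is no such class; so parities alone determine it.\<close>

definition decomposes :: "complex mat \<Rightarrow> complex mat list \<Rightarrow> complex mat \<Rightarrow> bool" where
  "decomposes A L \<rho> \<longleftrightarrow> set L \<subseteq> S \<and> \<rho> \<in> residues \<and> A = central_part L * \<rho> \<and>
     (\<forall>\<sigma> \<in> rep ` T. odd (class_count \<sigma> L) \<longleftrightarrow> \<sigma> = \<rho>)"

text \<open>In \<open>L @ L\<close> every multiplicity is even.\<close>

lemma central_part_square:
  assumes "set L \<subseteq> S"
  shows "central_part L * central_part L = one"
  using assms central_part_even_counts[of "L @ L"] by (simp add: central_part_append)

lemma central_part_mult_residues:
  assumes "set L \<subseteq> S" "set L' \<subseteq> S" "\<rho> \<in> residues" "\<rho>' \<in> residues"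
  shows "(central_part L * \<rho>) * (central_part L' * \<rho>') = central_part (L @ L') * (\<rho> * \<rho>')"
proof -
  let ?P = "central_part L" and ?Q = "central_part L'"
  note P = central_part_carrier[OF assms(1)] and Q = central_part_carrier[OF assms(2)]
    and r = residue_carrier[OF assms(3)] and r' = residue_carrier[OF assms(4)]
  have "(?P * \<rho>) * (?Q * \<rho>') = ?P * ((\<rho> * ?Q) * \<rho>')"
    unfolding assoc_mult_mat[OF P r mult_carrier_mat[OF Q r']] assoc_mult_mat[OF r Q r'] ..
  also have "\<rho> * ?Q = ?Q * \<rho>"
    using central_part_commute_residue[OF assms(2,3)] by (simp add: commute_def)
  also have "?P * ((?Q * \<rho>) * \<rho>') = (?P * ?Q) * (\<rho> * \<rho>')"
    unfolding assoc_mult_mat[OF Q r r'] assoc_mult_mat[OF P Q mult_carrier_mat[OF r r']] ..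
  finally show ?thesis using assms by (simp add: central_part_append)
qed

text \<open>Central parts are involutions and commute with each other and with all residues.
  Multiplying \<open>A\<close> and \<open>B\<close> by their central parts therefore isolates
  \<open>\<rho>\<close> and \<open>\<sigma>\<close> without disturbing commutation.\<close>

lemma decomposes_commute:
  assumes "decomposes A L \<rho>" "decomposes B L' \<sigma>" "commute A B"
  shows "commute \<rho> \<sigma>"
proof -
  have L: "set L \<subseteq> S" "set L' \<subseteq> S" and r: "\<rho> \<in> residues" "\<sigma> \<in> residues"
    and AB: "A = central_part L * \<rho>" "B = central_part L' * \<sigma>"
    using assms by (auto simp: decomposes_def)
  note P = central_part_carrier[OF L(1)] and Q = central_part_carrier[OF L(2)]
    and r' = r[THEN residue_carrier]
  have B: "B \<in> M" unfolding AB using Q r'(2) by (rule mult_carrier_mat)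
  have A: "A \<in> M" unfolding AB using P r'(1) by (rule mult_carrier_mat)
  have "commute (central_part L' * \<sigma>) (central_part L)"
    using central_part_commute[OF L(2,1)] commute_sym[OF central_part_commute_residue[OF L(1) r(2)]]
    by (rule commute_mult(1)[OF Q r'(2) P])
  then have "commute (central_part L * A) B"
    unfolding AB(2)[symmetric] by (intro commute_mult(1)[OF P A B] assms(3)) (rule commute_sym)
  moreover have "central_part L * A = \<rho>"
    unfolding AB(1) assoc_mult_mat[OF P P r'(1), symmetric] central_part_square[OF L(1)]
    by (rule left_mult_one_mat[OF r'(1)])
  ultimately have "commute B \<rho>" using commute_sym by simp
  moreover have "commute (central_part L') \<rho>" using central_part_commute_residue[OF L(2) r(1)] .
  ultimately have "commute (central_part L' * B) \<rho>"
    by (intro commute_mult(1)[OF Q B r'(1)])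
  moreover have "central_part L' * B = \<sigma>"
    unfolding AB(2) assoc_mult_mat[OF Q Q r'(2), symmetric] central_part_square[OF L(2)]
    by (rule left_mult_one_mat[OF r'(2)])
  ultimately show ?thesis using commute_sym by simp
qed

text \<open>The residues commute, so by \<open>rep_eq\<close> they are equal or one of them is
  \<open>one\<close>. Equal residues cancel, just as two odd leaf counts of a class add up to an
  even one.\<close>

lemma decomposes_mult:
  assumes A: "decomposes A L \<rho>" and B: "decomposes B L' \<sigma>" and c: "commute A B"
  shows "\<exists>\<tau>. decomposes (A * B) (L @ L') \<tau>"
proof -
  have rs: "\<rho> \<in> residues" "\<sigma> \<in> residues" using A B by (auto simp: decomposes_def)
  have prod: "A * B = central_part (L @ L') * (\<rho> * \<sigma>)"
    using A B central_part_mult_residues[of L L' \<rho> \<sigma>] by (simp add: decomposes_def)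
  have count: "class_count \<tau> (L @ L') = class_count \<tau> L + class_count \<tau> L'" for \<tau>
    by (simp add: class_count_def)
  have cases: "\<rho> = one \<or> \<sigma> = one \<or> \<rho> = \<sigma>"
    using decomposes_commute[OF A B c] rs rep_eq unfolding residues_def by blast
  note unit = left_mult_one_mat[OF residue_carrier[OF rs(2)]]
    right_mult_one_mat[OF residue_carrier[OF rs(1)]]
  \<comment> \<open>The inequality of truth values is exclusive or, which is how oddness behaves
    when counts are added.\<close>
  from cases have "\<rho> * \<sigma> \<in> residues \<and> (\<forall>\<tau> \<in> rep ` T. (\<tau> = \<rho> * \<sigma>) \<longleftrightarrow> (\<tau> = \<rho>) \<noteq> (\<tau> = \<sigma>))"
  proof (elim disjE)
    assume "\<rho> = one"
    then show ?thesis using rs rep_neq_one unit(1) by auto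
  next
    assume "\<sigma> = one"
    then show ?thesis using rs rep_neq_one unit(2) by auto
  next
    assume "\<rho> = \<sigma>"
    then show ?thesis using residue_square[OF rs(2)] rep_neq_one by (auto simp: residues_def)
  qed
  then have "decomposes (A * B) (L @ L') (\<rho> * \<sigma>)"
    using A B unfolding decomposes_def count prod by auto
  then show ?thesis by blast
qed

lemma decomposes_op_prod:
  assumes "\<And>t. t \<in> set ts \<Longrightarrow> root t \<in> M \<and> (\<exists>\<rho>. decomposes (root t) (leaves t) \<rho>)"
    and "\<And>t u. t \<in> set ts \<Longrightarrow> u \<in> set ts \<Longrightarrow> commute (root t) (root u)"
  shows "\<exists>\<rho>. decomposes (op_prod N (map root ts)) (concat (map leaves ts)) \<rho>"
  using assms
proof (induction ts)
  case Nil
  have "decomposes one [] one"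
    using rep_neq_one
    by (auto simp: decomposes_def residues_def central_part_def class_count_def dest: sym)
  then show ?case by auto
next
  case (Cons t ts)
  then obtain \<rho> \<sigma> where dec: "decomposes (root t) (leaves t) \<rho>"
    "decomposes (op_prod N (map root ts)) (concat (map leaves ts)) \<sigma>" by (metis list.set_intros)
  have "commute (op_prod N (map root ts)) (root t)"
    using Cons.prems by (intro commute_op_prod) auto
  from decomposes_mult[OF dec commute_sym[OF this]] show ?case by (simp add: op_prod_Cons)
qed

lemma decomposes_determining_tree:
  "determining_tree N S t \<Longrightarrow> \<exists>\<rho>. decomposes (root t) (leaves t) \<rho>"
proof (induction rule: determining_tree.induct)
  case (leaf B)
  note car = S_carrier[OF leaf(2)] rep_carrier[of B]
  \<comment> \<open>A leaf carries its representative twice, in the central part and as the residue,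
    and the two cancel.\<close>
  have "central_part [B] = B * rep B"
    using right_mult_one_mat[OF mult_carrier_mat[OF car]]
    by (simp add: central_part_def op_prod_Cons shifted_def)
  moreover have "(B * rep B) * rep B = B"
    unfolding assoc_mult_mat[OF car(1,2,2)] rep_square by (rule right_mult_one_mat[OF car(1)])
  ultimately have "decomposes B [B] (rep B)"
    using leaf rep_residue[of B] by (auto simp: decomposes_def class_count_def)
  then show ?case by auto
next
  case (parent A ts)
  have "\<exists>\<rho>. decomposes (op_prod N (map root ts)) (concat (map leaves ts)) \<rho>"
  proof (rule decomposes_op_prod)
    fix t assume "t \<in> set ts"
    with parent have "determining_tree N S t" "\<exists>\<rho>. decomposes (root t) (leaves t) \<rho>" by auto
    then show "root t \<in> M \<and> (\<exists>\<rho>. decomposes (root t) (leaves t) \<rho>)"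
      using pauli_ops_carrier[OF determining_tree_root] by simp
  qed (use parent in blast)
  then show ?case using parent by simp
qed

text \<open>Trees for \<open>A\<close> and \<open>- A\<close> with equal determining sets would have
  equal residues, and their joint central part would be the identity. Then \<open>A * - A\<close>
  would be the identity, although \<open>A\<close> squares to it.\<close>

theorem not_contextual: "\<not> contextual N S"
proof
  assume "contextual N S"
  then obtain A t t' where A: "A \<in> pauli_ops N"
    and t: "determining_tree N S t" "root t = A" and t': "determining_tree N S t'" "root t' = - A"
    and eq: "determining_set t = determining_set t'"
    unfolding contextual_def determining_tree_for_def by blast
  let ?L = "leaves t" and ?L' = "leaves t'"
  obtain \<rho> \<rho>' where dec: "decomposes A ?L \<rho>" "decomposes (- A) ?L' \<rho>'"
    using decomposes_determining_tree t t' by metis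
  \<comment> \<open>Equal determining sets mean equal parities in both leaf lists, so the sums are
    even.\<close>
  have even: "even (count_list (?L @ ?L') B)" for B
    using eq unfolding determining_set_def by auto
  have "even (class_count \<sigma> (?L @ ?L'))" for \<sigma>
    unfolding class_count_def by (rule even_length_filter_if_even_counts[OF even])
  then have "odd (class_count \<sigma> ?L) \<longleftrightarrow> odd (class_count \<sigma> ?L')" for \<sigma>
    by (simp add: class_count_def)
  then have same: "\<sigma> = \<rho> \<longleftrightarrow> \<sigma> = \<rho>'" if "\<sigma> \<in> rep ` T" for \<sigma>
    using dec that unfolding decomposes_def by metis
  have residues: "\<rho> \<in> residues" "\<rho>' \<in> residues" using dec by (simp_all add: decomposes_def)
  have \<rho>: "\<rho>' = \<rho>"
  proof (cases "\<rho> \<in> rep ` T \<or> \<rho>' \<in> rep ` T")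
    case True
    then show ?thesis using same by metis
  next
    case False
    \<comment> \<open>If neither residue represents a class, both are \<open>one\<close>.\<close>
    then show ?thesis using residues unfolding residues_def by (simp only: insert_iff simp_thms de_Morgan_disj)
  qed
  have L: "set ?L \<subseteq> S" "set ?L' \<subseteq> S" using dec by (simp_all add: decomposes_def)
  have "A * - A = (central_part ?L * \<rho>) * (central_part ?L' * \<rho>)"
    using dec unfolding decomposes_def \<rho> by metis
  also have "\<dots> = central_part (?L @ ?L') * (\<rho> * \<rho>)"
    by (rule central_part_mult_residues[OF L residues(1) residues(1)])
  also have "central_part (?L @ ?L') = one"
    using L by (intro central_part_even_counts even) simp
  also have "one * (\<rho> * \<rho>) = one" unfolding residue_square[OF residues(1)] by simp
  finally have "A * - A = one" .
  moreover have "A * - A = - (A * A)"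
    using pauli_ops_carrier[OF A] by (intro uminus_mult_right_mat) auto
  ultimately have "one = - one" unfolding pauli_ops_square[OF A] by (rule HOL.trans[OF sym])
  then show False by (rule notE[OF one_neq_uminus_one_mat])
qed

end

section \<open>Commutation tests\<close>

lemma result_andthen: "result c (andthen a f) = result c (f (result c a))"
  by (induction a) auto

lemma steps_andthen: "steps c (andthen a f) = steps c a + steps c (f (result c a))"
  by (induction a) auto

text \<open>Since \<open>tested\<close> covers all branches, the continuation counts at every value
  in \<open>set2_algorithm a\<close>, that is, every value \<open>a\<close> may return under any
  answers.\<close>

lemma tested_andthen: "tested (andthen a f) = tested a \<union> (\<Union>r \<in> set2_algorithm a. tested (f r))"
  by (induction a) auto

lemma set2_andthen: "set2_algorithm (andthen a f) = (\<Union>r \<in> set2_algorithm a. set2_algorithm (f r))"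
  by (induction a) auto

lemma result_search: "result c (search p xs) \<longleftrightarrow> (\<exists>x \<in> set xs. result c (p x))"
  by (induction xs) (auto simp: result_andthen)

lemma result_select: "result c (select p xs) = filter (\<lambda>x. result c (p x)) xs"
  by (induction xs) (auto simp: result_andthen)

lemma steps_search:
  assumes "\<And>x. x \<in> set xs \<Longrightarrow> steps c (p x) \<le> n"
  shows "steps c (search p xs) \<le> length xs * n"
  using assms
proof (induction xs)
  case (Cons x xs)
  from Cons have "steps c (p x) \<le> n" "steps c (search p xs) \<le> length xs * n" by auto
  then show ?case by (auto simp: steps_andthen)
qed simp

lemma steps_select:
  assumes "\<And>x. x \<in> set xs \<Longrightarrow> steps c (p x) \<le> n"
  shows "steps c (select p xs) \<le> length xs * n"
  using assms
proof (induction xs)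
  case (Cons x xs)
  from Cons have "steps c (p x) \<le> n" "steps c (select p xs) \<le> length xs * n" by auto
  then show ?case by (auto simp: steps_andthen)
qed simp

lemma tested_search: "tested (search p xs) \<subseteq> (\<Union>x \<in> set xs. tested (p x))"
  by (induction xs) (auto simp: tested_andthen split: if_splits)

lemma tested_select: "tested (select p xs) \<subseteq> (\<Union>x \<in> set xs. tested (p x))"
  by (induction xs) (auto simp: tested_andthen)

text \<open>Whatever the answers, only elements of the input are kept. This confines the later
  triple search to the given operators on every branch.\<close>

lemma set2_select: "ys \<in> set2_algorithm (select p xs) \<Longrightarrow> set ys \<subseteq> set xs"
proof (induction xs arbitrary: ys)
  case (Cons x xs)
  then obtain b zs where "zs \<in> set2_algorithm (select p xs)" "ys = (if b then x # zs else zs)"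
    by (auto simp: set2_andthen)
  with Cons.IH[of zs] show ?case by auto
qed simp

section \<open>Tests, result and cost of the decision algorithm\<close>

lemma tested_decide: "tested (decide_contextual xs) \<subseteq> set xs"
proof -
  have "tested (noncentral xs) \<subseteq> set xs"
    using tested_select tested_search unfolding noncentral_def by fastforce
  moreover have "tested (search (\<lambda>A. search (\<lambda>B. search (\<lambda>C. triple_test A B C) T) T) T) \<subseteq> set xs"
    if "set T \<subseteq> set xs" for T
  proof -
    have "tested (search (\<lambda>A. search (\<lambda>B. search (\<lambda>C. triple_test A B C) T) T) T) \<subseteq>
       (\<Union>A \<in> set T. \<Union>B \<in> set T. \<Union>C \<in> set T. tested (triple_test A B C))"
      by (intro order.trans[OF tested_search] UN_mono order.refl)
    also have "\<dots> \<subseteq> set T" by (auto simp: triple_test_def)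
    finally show ?thesis using that by simp
  qed
  moreover have "set T \<subseteq> set xs" if "T \<in> set2_algorithm (noncentral xs)" for T
    using that unfolding noncentral_def by (rule set2_select)
  ultimately show ?thesis
    unfolding decide_contextual_def tested_andthen by (intro Un_least UN_least) blast+
qed

lemma set_result_noncentral:
  "set (result c (noncentral xs)) = {A \<in> set xs. \<exists>B \<in> set xs. \<not> c A B}"
  by (simp add: noncentral_def result_select result_search)

lemma result_decide:
  "result c (decide_contextual xs) \<longleftrightarrow>
    (let T = {A \<in> set xs. \<exists>B \<in> set xs. \<not> c A B}
     in \<exists>A \<in> T. \<exists>B \<in> T. \<exists>C \<in> T. c A B \<and> c A C \<and> \<not> c B C)"
  unfolding set_result_noncentral[symmetric]
  by (simp add: decide_contextual_def result_andthen result_search triple_test_def Let_def)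

text \<open>For \<open>n\<close> operators, removing the central ones takes at most
  \<open>n ^ 2 \<le> n ^ 3\<close> tests, and each of at most \<open>n ^ 3\<close> triples takes 3
  tests; hence the factor 4.\<close>

lemma steps_decide: "steps c (decide_contextual xs) \<le> 4 * length xs ^ 3"
proof -
  define T where "T = result c (noncentral xs)"
  have T: "length T \<le> length xs"
    by (simp add: T_def noncentral_def result_select)
  have "steps c (noncentral xs) \<le> length xs * (length xs * 1)"
    unfolding noncentral_def by (intro steps_select steps_search) simp
  also have "\<dots> \<le> length xs ^ 3"
    by (cases xs) (auto simp: power3_eq_cube)
  finally have "steps c (noncentral xs) \<le> length xs ^ 3" .
  moreover have "steps c (search (\<lambda>A. search (\<lambda>B. search (\<lambda>C. triple_test A B C) T) T) T)
      \<le> length T * (length T * (length T * 3))"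
    by (intro steps_search) (simp add: triple_test_def)
  moreover have "length T * (length T * (length T * 3)) \<le> 3 * length xs ^ 3"
    using power_mono[OF T, of 3] by (simp add: power3_eq_cube)
  ultimately show ?thesis by (simp add: decide_contextual_def steps_andthen T_def)
qed

section \<open>The criterion and the algorithm\<close>

text \<open>As \<open>A\<close> commutes with itself, a partner that does not commute with
  \<open>A\<close> is automatically different from it.\<close>

lemma remove_central_eq: "remove_central S = {A \<in> S. \<exists>B \<in> S. \<not> commute A B}"
  unfolding remove_central_def using commute_refl by blast

lemma contextual_iff:
  assumes S: "S \<subseteq> pauli_ops N"
  defines "T \<equiv> {A \<in> S. \<exists>B \<in> S. \<not> commute A B}"
  shows "contextual N S \<longleftrightarrow> (\<exists>A \<in> T. \<exists>B \<in> T. \<exists>C \<in> T. commute A B \<and> commute A C \<and> \<not> commute B C)"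
    (is "_ \<longleftrightarrow> ?triple")
proof
  assume ?triple
  then obtain A B C where ABC: "A \<in> T" "B \<in> T" "C \<in> T" "commute A B" "commute A C" "\<not> commute B C"
    by blast
  \<comment> \<open>Being noncentral, \<open>A\<close> has a partner \<open>D\<close> in
    \<open>S\<close>, the fourth operator needed for the square.\<close>
  then obtain D where D: "A \<in> S" "B \<in> S" "C \<in> S" "D \<in> S" "\<not> commute A D" unfolding T_def by blast
  have "anticommute B C" "anticommute A D"
    using ABC(6) D S pauli_ops_anticommute_iff by blast+
  with S D(1-4) ABC(4,5) show "contextual N S" by (rule contextual_if_triple)
next
  assume contextual: "contextual N S"
  show ?triple
  proof (rule ccontr)
    assume "\<not> ?triple"
    \<comment> \<open>A failure of transitivity at \<open>A\<close>, \<open>B\<close>,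
      \<open>C\<close> would be a triple whose first member is the middle operator
      \<open>B\<close>.\<close>
    then interpret commutation_classes N S T
      using S T_def by unfold_locales (use commute_sym in blast)+
    from not_contextual contextual show False by contradiction
  qed
qed

lemma contextual_iff_anticommute:
  assumes "S \<subseteq> pauli_ops N" "T = remove_central S"
  shows "contextual N S \<longleftrightarrow> (\<exists>A \<in> T. \<exists>B \<in> T. \<exists>C \<in> T. commute A B \<and> commute A C \<and> anticommute B C)"
proof -
  have "anticommute B C \<longleftrightarrow> \<not> commute B C" if "B \<in> T" "C \<in> T" for B C
    using that assms pauli_ops_anticommute_iff unfolding remove_central_eq by blast
  then show ?thesis
    unfolding contextual_iff[OF assms(1)] assms(2)[unfolded remove_central_eq, symmetric] by metis
qed

theorem mainTheorem4:
  shows "(\<exists>c :: nat. \<forall>N :: nat. \<forall>S :: complex mat set. \<forall>xs :: complex mat list.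
            N \<ge> 1 \<longrightarrow> finite S \<longrightarrow> S \<subseteq> pauli_ops N \<longrightarrow> set xs = S \<longrightarrow> distinct xs \<longrightarrow>
              tested (decide_contextual xs) \<subseteq> S \<and>
              (result commute (decide_contextual xs) \<longleftrightarrow> contextual N S) \<and>
              steps commute (decide_contextual xs) \<le> c * card S ^ 3) \<and>
         (\<forall>N :: nat. \<forall>S :: complex mat set. \<forall>T :: complex mat set.
            N \<ge> 1 \<longrightarrow> finite S \<longrightarrow> S \<subseteq> pauli_ops N \<longrightarrow> T = remove_central S \<longrightarrow>
              ((\<exists>A \<in> T. \<exists>B \<in> T. \<exists>C \<in> T. commute A B \<and> commute A C \<and> anticommute B C)
                 \<longrightarrow> contextual N S) \<and>
              (\<not> (\<exists>A \<in> T. \<exists>B \<in> T. \<exists>C \<in> T. commute A B \<and> commute A C \<and> anticommute B C)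
                 \<longrightarrow> \<not> contextual N S))"
\<comment> \<open>The constant comes from \<open>steps_decide\<close>; distinctness turns the length
  of \<open>xs\<close> into \<open>card S\<close>.\<close>
proof (intro conjI exI[of _ 4] allI impI)
  fix N S and xs :: "complex mat list"
  assume "S \<subseteq> pauli_ops N" "set xs = S" "distinct xs"
  then show "tested (decide_contextual xs) \<subseteq> S"
    "result commute (decide_contextual xs) \<longleftrightarrow> contextual N S"
    "steps commute (decide_contextual xs) \<le> 4 * card S ^ 3"
    using tested_decide[of xs] steps_decide[of commute xs]
    by (auto simp: result_decide contextual_iff Let_def distinct_card)
qed (simp_all add: contextual_iff_anticommute)

end
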